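(* Let $\mathcal U\subseteq\mathcal T_n$ be an admissible tree set. Assume the output distance is generated by the norm $\|\cdot\|$ used in $\Delta_2^{\mathcal U}$, i.e. $d(q,q')=\|q-q'\|$, and that the tree expansions $F_{T,\mathbf w}^\varepsilon=p+\varepsilon H+\varepsilon^2B_T+o(\varepsilon^2)$ hold in that norm uniformly over $T\in\mathcal U$. Let $\mathcal Q$ be a uniformly bounded class of measurable functions, i.e. $\sup_{\varphi\in\mathcal Q}\|\varphi\|_\infty<\infty$, and assume that the tree expansions hold in $L^1(\mu)$. Then, as $\varepsilon\to0$, \[ \operatorname{AOD}_{f,\mathbf w}^{\mathcal U}(p_1^\varepsilon,\dots,p_n^\varepsilon)=\varepsilon^2\Delta_2^{\mathcal U}+o(\varepsilon^2) \] and \[ \operatorname{AOD}_{f,\mathbf w,\mathcal Q}^{\mathcal U}(p_1^\varepsilon,\dots,p_n^\varepsilon)=\varepsilon^2\Delta_{2,\mathcal Q}^{\mathcal U}+o(\varepsilon^2). \]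
   Context: $(\Omega,\mathcal F,\mu)$ is a measure space and $p$ a strictly positive probability density with respect to $\mu$. For measurable $q$ with $q/p\in L^\infty(\mu)$, $\|q\|_{p,\infty}=\|q/p\|_\infty$. The real parameter $\varepsilon\ne0$ tends to $0$. Generator: $f:(0,\infty)\to\mathbb R$ is convex and $C^3$ in a neighborhood of $1$, with $f(1)=f'(1)=0$, $f''(1)>0$; $A_2=f''(1)/2$, $A_3=f'''(1)/6$; $D_f(r\|q)=\int_\Omega q f(r/q)\,d\mu$. Coefficient $\tau$: for $a,b>0$ and bounded measurable $u,v$ with $\Delta=v-u$, $J=\int\Delta^2p\,d\mu>0$, $L_3=\int\Delta^3p\,d\mu$, $t_0=\frac{\sqrt b}{\sqrt a+\sqrt b}$, \[ \tau(a,b;u,v)=\frac{A_3L_3\{at_0^3+b(1-t_0)^3\}}{2A_2J\{at_0+b(1-t_0)\}}. \] Trees: $\mathcal T_n$ ($n\ge2$ fixed) is the set of full ordered binary trees with $n$ leaves, labelled $1,\dots,n$ from left to right; the block of a node is the set of (consecutive) leaves below it, and an internal node merges the adjacent blocks $A$ (left child) and $B$ (right child) into $AB$. Leaves: $\mathbf w=(w_1,\dots,w_n)\in(0,\infty)^n$, $G_i=\sqrt{w_i}$, and the leaf inputs are probability densities $p_i^\varepsilon=p+\varepsilon h_i+\varepsilon^2B_i+o(\varepsilon^2)$ (remainder in $\|\cdot\|_{p,\infty}$) with $\int h_i\,d\mu=\int B_i\,d\mu=0$ and $h_i/p,B_i/p$ bounded. Recursion: for a block, $G_A=\sum_{i\in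 A}G_i$. At leaves $H_i=h_i$ and the second-order coefficient is $B_i$. When a node merges $A$ and $B$, with $\theta_{AB}=\frac{G_B}{G_A+G_B}$, \[ H_{AB}=\frac{G_AH_A+G_BH_B}{G_A+G_B},\qquad B_{AB}=(1-\theta_{AB})B_A+\theta_{AB}B_B+\tau(G_A^2,G_B^2;H_A/p,H_B/p)(H_B-H_A). \] $B_T$ is the resulting coefficient at the root of $T$, and $H=\sum_iG_ih_i/\sum_iG_i$ is the root first-order coefficient (the same for all trees). Admissibility: a nonempty $\mathcal U\subseteq\mathcal T_n$ is an admissible tree set if, for all trees in $\mathcal U$, all coefficients $H_A,B_A$ generated by the recursion have $H_A/p,B_A/p\in L^\infty(\mu)$ and every generated merge is nondegenerate: $J(A,B)=\int_\Omega\left(\frac{H_B-H_A}{p}\right)^2p\,d\mu>0$. Mass-carrying protocol: for $T\in\mathcal U$, leaf $i$ has state $(G_i,p_i^\varepsilon)$. At a merge of $A$ and $B$, $G_{AB}=G_A+G_B$ and $q_{AB}^\varepsilon=(1-t_{AB}^\varepsilon)q_A^\varepsilon+t_{AB}^\varepsilon q_B^\varepsilon$, where $t_{AB}^\varepsilon\in[0,1]$ is the local solution of $G_A^2D_f(q_A^\varepsilon\|q_{AB}^\varepsilon)=G_B^2D_f(q_B^\varepsilon\|q_{AB}^\varepsilon)$ converging to $\frac{G_B}{G_A+G_B}$ as $\varepsilon\to0$ (for small $\varepsilon\neq 0$, the unique solution in a fixed small neighborhood of that value). The root density is $F_{T,\mathbf w}^\varepsilon$. Diameters: with $d$ the output distance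 on densities, \[ \operatorname{AOD}_{f,\mathbf w}^{\mathcal U}(p_1^\varepsilon,\dots,p_n^\varepsilon)=\sup_{T,T'\in\mathcal U}d(F_{T,\mathbf w}^\varepsilon,F_{T',\mathbf w}^\varepsilon), \] \[ \operatorname{AOD}_{f,\mathbf w,\mathcal Q}^{\mathcal U}(p_1^\varepsilon,\dots,p_n^\varepsilon)=\sup_{\varphi\in\mathcal Q}\sup_{T,T'\in\mathcal U}\left|\int_\Omega\varphi\{F_{T,\mathbf w}^\varepsilon-F_{T',\mathbf w}^\varepsilon\}\,d\mu\right|. \] With $\mathcal S_{\mathcal U}=\{B_T\mid T\in\mathcal U\}$ and $\|\cdot\|$ a norm on the local chart (on zero-mass functions $g$ with $g/p\in L^\infty(\mu)$), \[ \Delta_2^{\mathcal U}=\sup_{B,B'\in\mathcal S_{\mathcal U}}\|B-B'\|,\qquad \Delta_{2,\mathcal Q}^{\mathcal U}=\sup_{\varphi\in\mathcal Q}\sup_{B,B'\in\mathcal S_{\mathcal U}}\left|\int_\Omega\varphi(B-B')\,d\mu\right|. \] *)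

theory Defs
  imports
    "HOL-Analysis.Analysis"
    "HOL-Probability.Essential_Supremum"
    "HOL-Library.Landau_Symbols"
begin

section \<open>Densities, weighted sup norm, divergence\<close>

text \<open>
  Densities and tangent functions are real functions that are identified when they agree
  almost everywhere; accordingly all pointwise conditions on them are imposed almost everywhere.
\<close>

definition prob_density :: "'a measure \<Rightarrow> ('a \<Rightarrow> real) \<Rightarrow> bool" where
  "prob_density M q \<longleftrightarrow> integrable M q \<and> (AE x in M. 0 \<le> q x) \<and> (\<integral>x. q x \<partial>M) = 1"

definition norm_inf :: "'a measure \<Rightarrow> ('a \<Rightarrow> real) \<Rightarrow> ereal" where
  "norm_inf M g = esssup M (\<lambda>x. ereal \<bar>g x\<bar>)"

definition Linf :: "'a measure \<Rightarrow> ('a \<Rightarrow> real) set" where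
  "Linf M = {g \<in> borel_measurable M. norm_inf M g < \<infinity>}"

definition norm_p_inf :: "'a measure \<Rightarrow> ('a \<Rightarrow> real) \<Rightarrow> ('a \<Rightarrow> real) \<Rightarrow> ereal" where
  "norm_p_inf M p q = norm_inf M (\<lambda>x. q x / p x)"

definition local_chart :: "'a measure \<Rightarrow> ('a \<Rightarrow> real) \<Rightarrow> ('a \<Rightarrow> real) set" where
  "local_chart M p =
     {g \<in> borel_measurable M. (\<lambda>x. g x / p x) \<in> Linf M \<and> (\<integral>x. g x \<partial>M) = 0}"

text \<open>A norm on the a.e.-classes of the chart; invariance under a.e. equality follows from the
  triangle inequality together with definiteness.\<close>

definition norm_on_chart ::
    "'a measure \<Rightarrow> ('a \<Rightarrow> real) \<Rightarrow> (('a \<Rightarrow> real) \<Rightarrow> real) \<Rightarrow> bool" where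
  "norm_on_chart M p N \<longleftrightarrow>
     (\<forall>g \<in> local_chart M p. 0 \<le> N g \<and> (N g = 0 \<longleftrightarrow> (AE x in M. g x = 0))) \<and>
     (\<forall>g \<in> local_chart M p. \<forall>c. N (\<lambda>x. c * g x) = \<bar>c\<bar> * N g) \<and>
     (\<forall>g \<in> local_chart M p. \<forall>g' \<in> local_chart M p. N (\<lambda>x. g x + g' x) \<le> N g + N g')"

definition f_div ::
    "'a measure \<Rightarrow> (real \<Rightarrow> real) \<Rightarrow> ('a \<Rightarrow> real) \<Rightarrow> ('a \<Rightarrow> real) \<Rightarrow> real" where
  "f_div M f r q = (\<integral>x. q x * f (r x / q x) \<partial>M)"

section \<open>Generator\<close>

definition C_k_on :: "nat \<Rightarrow> (real \<Rightarrow> real) \<Rightarrow> real set \<Rightarrow> bool" where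
  "C_k_on k f S \<longleftrightarrow>
     (\<forall>j<k. \<forall>x\<in>S. (deriv ^^ j) f field_differentiable (at x)) \<and>
     continuous_on S ((deriv ^^ k) f)"

text \<open>Only the values of \<open>f\<close> on the positive half-line matter.\<close>

definition generator :: "(real \<Rightarrow> real) \<Rightarrow> bool" where
  "generator f \<longleftrightarrow>
     convex_on {0<..} f \<and>
     (\<exists>S. open S \<and> 1 \<in> S \<and> S \<subseteq> {0<..} \<and> C_k_on 3 f S) \<and>
     f 1 = 0 \<and> deriv f 1 = 0 \<and> (deriv ^^ 2) f 1 > 0"

definition A2 :: "(real \<Rightarrow> real) \<Rightarrow> real" where
  "A2 f = (deriv ^^ 2) f 1 / 2"

definition A3 :: "(real \<Rightarrow> real) \<Rightarrow> real" where
  "A3 f = (deriv ^^ 3) f 1 / 6"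

definition tau ::
    "'a measure \<Rightarrow> ('a \<Rightarrow> real) \<Rightarrow> (real \<Rightarrow> real) \<Rightarrow> real \<Rightarrow> real \<Rightarrow> ('a \<Rightarrow> real) \<Rightarrow> ('a \<Rightarrow> real) \<Rightarrow> real"
  where
  "tau M p f a b u v =
     (let J = (\<integral>x. (v x - u x) ^ 2 * p x \<partial>M);
          L3 = (\<integral>x. (v x - u x) ^ 3 * p x \<partial>M);
          t0 = sqrt b / (sqrt a + sqrt b)
      in A3 f * L3 * (a * t0 ^ 3 + b * (1 - t0) ^ 3) /
         (2 * A2 f * J * (a * t0 + b * (1 - t0))))"

section \<open>Full ordered binary trees\<close>

datatype otree = Lf nat | Merge otree otree

primrec leaves :: "otree \<Rightarrow> nat list" where
  "leaves (Lf i) = [i]"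
| "leaves (Merge l r) = leaves l @ leaves r"

definition ordered_trees :: "nat \<Rightarrow> otree set" where
  "ordered_trees n = {T. leaves T = [1..<n + 1]}"

definition block :: "otree \<Rightarrow> nat set" where
  "block T = set (leaves T)"

primrec subtrees :: "otree \<Rightarrow> otree set" where
  "subtrees (Lf i) = {Lf i}"
| "subtrees (Merge l r) = insert (Merge l r) (subtrees l \<union> subtrees r)"

section \<open>First- and second-order coefficients\<close>

definition block_mass :: "(nat \<Rightarrow> real) \<Rightarrow> otree \<Rightarrow> real" where
  "block_mass w T = (\<Sum>i\<in>block T. sqrt (w i))"

definition merge_ratio :: "(nat \<Rightarrow> real) \<Rightarrow> otree \<Rightarrow> otree \<Rightarrow> real" where
  "merge_ratio w l r = block_mass w r / (block_mass w l + block_mass w r)"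

primrec coeff_H :: "(nat \<Rightarrow> real) \<Rightarrow> (nat \<Rightarrow> 'a \<Rightarrow> real) \<Rightarrow> otree \<Rightarrow> 'a \<Rightarrow> real" where
  "coeff_H w h (Lf i) = h i"
| "coeff_H w h (Merge l r) =
     (\<lambda>x. (block_mass w l * coeff_H w h l x + block_mass w r * coeff_H w h r x) /
          (block_mass w l + block_mass w r))"

primrec coeff_B ::
    "'a measure \<Rightarrow> ('a \<Rightarrow> real) \<Rightarrow> (real \<Rightarrow> real) \<Rightarrow> (nat \<Rightarrow> real) \<Rightarrow>
     (nat \<Rightarrow> 'a \<Rightarrow> real) \<Rightarrow> (nat \<Rightarrow> 'a \<Rightarrow> real) \<Rightarrow> otree \<Rightarrow> 'a \<Rightarrow> real" where
  "coeff_B M p f w h B (Lf i) = B i"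
| "coeff_B M p f w h B (Merge l r) =
     (\<lambda>x. (1 - merge_ratio w l r) * coeff_B M p f w h B l x
          + merge_ratio w l r * coeff_B M p f w h B r x
          + tau M p f ((block_mass w l)\<^sup>2) ((block_mass w r)\<^sup>2)
              (\<lambda>y. coeff_H w h l y / p y) (\<lambda>y. coeff_H w h r y / p y)
            * (coeff_H w h r x - coeff_H w h l x))"

definition root_H :: "nat \<Rightarrow> (nat \<Rightarrow> real) \<Rightarrow> (nat \<Rightarrow> 'a \<Rightarrow> real) \<Rightarrow> 'a \<Rightarrow> real" where
  "root_H n w h = (\<lambda>x. (\<Sum>i=1..n. sqrt (w i) * h i x) / (\<Sum>i=1..n. sqrt (w i)))"

definition merge_J ::
    "'a measure \<Rightarrow> ('a \<Rightarrow> real) \<Rightarrow> (nat \<Rightarrow> real) \<Rightarrow> (nat \<Rightarrow> 'a \<Rightarrow> real) \<Rightarrow> otree \<Rightarrow> otree \<Rightarrow> real" where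
  "merge_J M p w h l r = (\<integral>x. ((coeff_H w h r x - coeff_H w h l x) / p x) ^ 2 * p x \<partial>M)"

definition admissible ::
    "'a measure \<Rightarrow> ('a \<Rightarrow> real) \<Rightarrow> (real \<Rightarrow> real) \<Rightarrow> nat \<Rightarrow> (nat \<Rightarrow> real) \<Rightarrow>
     (nat \<Rightarrow> 'a \<Rightarrow> real) \<Rightarrow> (nat \<Rightarrow> 'a \<Rightarrow> real) \<Rightarrow> otree set \<Rightarrow> bool" where
  "admissible M p f n w h B U \<longleftrightarrow>
     U \<noteq> {} \<and> U \<subseteq> ordered_trees n \<and>
     (\<forall>T\<in>U. \<forall>A\<in>subtrees T.
        (\<lambda>x. coeff_H w h A x / p x) \<in> Linf M \<and> (\<lambda>x. coeff_B M p f w h B A x / p x) \<in> Linf M) \<and>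
     (\<forall>T\<in>U. \<forall>l r. Merge l r \<in> subtrees T \<longrightarrow> 0 < merge_J M p w h l r)"

section \<open>Mass-carrying protocol\<close>

definition mixture :: "real \<Rightarrow> ('a \<Rightarrow> real) \<Rightarrow> ('a \<Rightarrow> real) \<Rightarrow> 'a \<Rightarrow> real" where
  "mixture s q q' = (\<lambda>x. (1 - s) * q x + s * q' x)"

definition balanced ::
    "'a measure \<Rightarrow> (real \<Rightarrow> real) \<Rightarrow> real \<Rightarrow> real \<Rightarrow> ('a \<Rightarrow> real) \<Rightarrow> ('a \<Rightarrow> real) \<Rightarrow> real \<Rightarrow> bool" where
  "balanced M f GA GB qA qB s \<longleftrightarrow>
     GA\<^sup>2 * f_div M f qA (mixture s qA qB) = GB\<^sup>2 * f_div M f qB (mixture s qA qB)"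

definition local_solution ::
    "'a measure \<Rightarrow> (real \<Rightarrow> real) \<Rightarrow> real \<Rightarrow> real \<Rightarrow>
     (real \<Rightarrow> 'a \<Rightarrow> real) \<Rightarrow> (real \<Rightarrow> 'a \<Rightarrow> real) \<Rightarrow> (real \<Rightarrow> real) \<Rightarrow> bool" where
  "local_solution M f GA GB qA qB t \<longleftrightarrow>
     (t \<longlongrightarrow> GB / (GA + GB)) (at 0) \<and>
     (\<exists>\<delta>>0. \<forall>\<^sub>F \<epsilon> in at 0.
        t \<epsilon> \<in> {0..1} \<and> balanced M f GA GB (qA \<epsilon>) (qB \<epsilon>) (t \<epsilon>) \<and>
        (\<forall>s\<in>{0..1}. \<bar>s - GB / (GA + GB)\<bar> < \<delta> \<and> balanced M f GA GB (qA \<epsilon>) (qB \<epsilon>) s \<longrightarrow> s = t \<epsilon>))"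

text \<open>The state (mass, density) carried by a node. Leaf \<open>i\<close> has input \<open>P i \<epsilon>\<close>, and \<open>t l r \<epsilon>\<close>
  is the weight used when the subtrees \<open>l\<close> and \<open>r\<close> are merged.\<close>

primrec state ::
    "(nat \<Rightarrow> real) \<Rightarrow> (nat \<Rightarrow> real \<Rightarrow> 'a \<Rightarrow> real) \<Rightarrow> (otree \<Rightarrow> otree \<Rightarrow> real \<Rightarrow> real) \<Rightarrow>
     otree \<Rightarrow> real \<Rightarrow> real \<times> ('a \<Rightarrow> real)" where
  "state w P t (Lf i) = (\<lambda>\<epsilon>. (sqrt (w i), P i \<epsilon>))"
| "state w P t (Merge l r) = (\<lambda>\<epsilon>.
     (fst (state w P t l \<epsilon>) + fst (state w P t r \<epsilon>),
      mixture (t l r \<epsilon>) (snd (state w P t l \<epsilon>)) (snd (state w P t r \<epsilon>))))"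

definition root_density ::
    "(nat \<Rightarrow> real) \<Rightarrow> (nat \<Rightarrow> real \<Rightarrow> 'a \<Rightarrow> real) \<Rightarrow> (otree \<Rightarrow> otree \<Rightarrow> real \<Rightarrow> real) \<Rightarrow>
     otree \<Rightarrow> real \<Rightarrow> 'a \<Rightarrow> real" where
  "root_density w P t T \<epsilon> = snd (state w P t T \<epsilon>)"

text \<open>The masses do not depend on \<open>\<epsilon>\<close>; they are read off at \<open>\<epsilon> = 0\<close>.\<close>

definition mass_carrying_protocol ::
    "'a measure \<Rightarrow> (real \<Rightarrow> real) \<Rightarrow> (nat \<Rightarrow> real) \<Rightarrow> (nat \<Rightarrow> real \<Rightarrow> 'a \<Rightarrow> real) \<Rightarrow> otree set \<Rightarrow>
     (otree \<Rightarrow> otree \<Rightarrow> real \<Rightarrow> real) \<Rightarrow> bool" where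
  "mass_carrying_protocol M f w P U t \<longleftrightarrow>
     (\<forall>T\<in>U. \<forall>l r. Merge l r \<in> subtrees T \<longrightarrow>
        local_solution M f (fst (state w P t l 0)) (fst (state w P t r 0))
          (\<lambda>\<epsilon>. snd (state w P t l \<epsilon>)) (\<lambda>\<epsilon>. snd (state w P t r \<epsilon>)) (t l r))"

section \<open>Diameters\<close>

text \<open>All diameters are suprema in \<open>[0, \<infinity>]\<close>, so that the supremum over an empty class is \<open>0\<close>.\<close>

definition AOD ::
    "(('a \<Rightarrow> real) \<Rightarrow> ('a \<Rightarrow> real) \<Rightarrow> real) \<Rightarrow> (nat \<Rightarrow> real) \<Rightarrow> (nat \<Rightarrow> real \<Rightarrow> 'a \<Rightarrow> real) \<Rightarrow>
     (otree \<Rightarrow> otree \<Rightarrow> real \<Rightarrow> real) \<Rightarrow> otree set \<Rightarrow> real \<Rightarrow> ennreal" where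
  "AOD d w P t U \<epsilon> =
     (SUP T\<in>U. SUP T'\<in>U. ennreal (d (root_density w P t T \<epsilon>) (root_density w P t T' \<epsilon>)))"

definition AOD_Q ::
    "'a measure \<Rightarrow> ('a \<Rightarrow> real) set \<Rightarrow> (nat \<Rightarrow> real) \<Rightarrow> (nat \<Rightarrow> real \<Rightarrow> 'a \<Rightarrow> real) \<Rightarrow>
     (otree \<Rightarrow> otree \<Rightarrow> real \<Rightarrow> real) \<Rightarrow> otree set \<Rightarrow> real \<Rightarrow> ennreal" where
  "AOD_Q M Q w P t U \<epsilon> =
     (SUP \<phi>\<in>Q. SUP T\<in>U. SUP T'\<in>U.
        ennreal \<bar>\<integral>x. \<phi> x * (root_density w P t T \<epsilon> x - root_density w P t T' \<epsilon> x) \<partial>M\<bar>)"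

definition Delta2 :: "(('a \<Rightarrow> real) \<Rightarrow> real) \<Rightarrow> ('a \<Rightarrow> real) set \<Rightarrow> ennreal" where
  "Delta2 N S = (SUP B\<in>S. SUP B'\<in>S. ennreal (N (\<lambda>x. B x - B' x)))"

definition Delta2_Q :: "'a measure \<Rightarrow> ('a \<Rightarrow> real) set \<Rightarrow> ('a \<Rightarrow> real) set \<Rightarrow> ennreal" where
  "Delta2_Q M Q S = (SUP \<phi>\<in>Q. SUP B\<in>S. SUP B'\<in>S. ennreal \<bar>\<integral>x. \<phi> x * (B x - B' x) \<partial>M\<bar>)"

text \<open>\<open>X \<epsilon> = \<epsilon>\<^sup>2 D + o(\<epsilon>\<^sup>2)\<close> as \<open>\<epsilon> \<rightarrow> 0\<close>, \<open>\<epsilon> \<noteq> 0\<close>. The finiteness clauses are needed because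
  \<^term>\<open>enn2real\<close> sends \<open>\<infinity>\<close> to \<open>0\<close>.\<close>

definition quadratic_asymptotic :: "(real \<Rightarrow> ennreal) \<Rightarrow> ennreal \<Rightarrow> bool" where
  "quadratic_asymptotic X D \<longleftrightarrow>
     D < \<infinity> \<and> (\<forall>\<^sub>F \<epsilon> in at 0. X \<epsilon> < \<infinity>) \<and>
     (\<lambda>\<epsilon>. enn2real (X \<epsilon>) - \<epsilon>\<^sup>2 * enn2real D) \<in> o[at 0](\<lambda>\<epsilon>. \<epsilon>\<^sup>2)"

end

(* The root densities differ by F_T - F_T' = eps^2 (B_T - B_T') + (R_T - R_T'), because the first-order
   coefficient H is common to all trees. The triangle inequality, for the norm or for the pairing
   with a bounded test function, therefore compares the two families under the suprema up to
   o(eps^2), uniformly over pairs of trees; for the L1 expansions the uniformity comes from the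
   finiteness of the set of trees. The remainders R_T lie in the chart, where the norm axioms apply,
   since mixing probability densities preserves the condition that q - p be in the chart. *)

theory Submission
  imports Defs
begin

section \<open>Suprema over index families and finiteness of the set of trees\<close>

lemma SUP_Times:
  fixes g :: "'i \<Rightarrow> 'j \<Rightarrow> 'b::complete_lattice"
  shows "(SUP i\<in>I. SUP j\<in>J. g i j) = (SUP (i, j)\<in>I \<times> J. g i j)"
proof (rule antisym)
  have "g i j \<le> (SUP (i, j)\<in>I \<times> J. g i j)" if "i \<in> I" "j \<in> J" for i j
    using that by (intro SUP_upper2[of "(i, j)"]) auto
  then show "(SUP i\<in>I. SUP j\<in>J. g i j) \<le> (SUP (i, j)\<in>I \<times> J. g i j)"
    by (intro SUP_least)
  have "g i j \<le> (SUP i\<in>I. SUP j\<in>J. g i j)" if "i \<in> I" "j \<in> J" for i j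
    using that by (intro SUP_upper2[of i] SUP_upper)
  then show "(SUP (i, j)\<in>I \<times> J. g i j) \<le> (SUP i\<in>I. SUP j\<in>J. g i j)"
    by (auto intro: SUP_least)
qed

text \<open>A tree with leaf list \<open>xs\<close> is a single leaf or cuts \<open>xs\<close> into
  the lists of its two children. No leaf list is empty, so the cut lies strictly inside
  \<open>xs\<close> and both pieces are shorter. By induction on length, each of the finitely many
  cuts admits finitely many trees.\<close>

lemma finite_leaves_eq: "finite {T. leaves T = xs}"
proof (induction xs rule: length_induct)
  case (1 xs)
  have nonempty: "leaves T \<noteq> []" for T
    by (induction T) auto
  let ?cut = "\<lambda>k. (\<lambda>(l, r). Merge l r) `
    ({T. leaves T = take k xs} \<times> {T. leaves T = drop k xs})"
  have "T \<in> Lf ` set xs \<union> (\<Union>k\<in>{0<..<length xs}. ?cut k)" if "leaves T = xs" for T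
  proof (cases T)
    case (Lf i)
    then show ?thesis using that by auto
  next
    case (Merge l r)
    then have "length (leaves l) \<in> {0<..<length xs}" "T \<in> ?cut (length (leaves l))"
      using that nonempty[of l] nonempty[of r] by auto
    then show ?thesis by blast
  qed
  then have "{T. leaves T = xs} \<subseteq> Lf ` set xs \<union> (\<Union>k\<in>{0<..<length xs}. ?cut k)"
    by blast
  moreover have "finite (Lf ` set xs \<union> (\<Union>k\<in>{0<..<length xs}. ?cut k))"
    using 1 by (intro finite_UnI finite_imageI finite_UN_I finite_cartesian_product) auto
  ultimately show ?case
    by (rule finite_subset)
qed

text \<open>Taking suprema is 1-Lipschitz for the uniform distance, so an error that is uniform in
  the index passes to the suprema unchanged. The bound \<open>K\<close> makes the coefficient
  finite; finiteness on the left then follows from closeness. For empty \<open>I\<close> both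
  suprema are 0.\<close>

lemma quadratic_asymptotic_SUP:
  fixes x :: "real \<Rightarrow> 'i \<Rightarrow> real"
  assumes y_bounds: "\<And>i. i \<in> I \<Longrightarrow> 0 \<le> y i" "\<And>i. i \<in> I \<Longrightarrow> y i \<le> K"
    and approx: "\<And>\<eta>. 0 < \<eta> \<Longrightarrow>
      \<forall>\<^sub>F \<epsilon> in at 0. \<forall>i\<in>I. \<bar>x \<epsilon> i - \<epsilon>\<^sup>2 * y i\<bar> \<le> \<eta> * \<epsilon>\<^sup>2"
  shows "quadratic_asymptotic (\<lambda>\<epsilon>. SUP i\<in>I. ennreal (x \<epsilon> i)) (SUP i\<in>I. ennreal (y i))"
proof -
  define X where "X \<epsilon> = (SUP i\<in>I. ennreal (x \<epsilon> i))" for \<epsilon>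
  define D where "D = (SUP i\<in>I. ennreal (y i))"
  have "D \<le> ennreal K"
    unfolding D_def using y_bounds by (intro SUP_least ennreal_leI)
  then have D_fin: "D < \<infinity>"
    using le_less_trans by fastforce
  then obtain D' where D': "D = ennreal D'" "0 \<le> D'"
    by (cases D) auto
  have "X \<epsilon> < \<infinity> \<and> \<bar>enn2real (X \<epsilon>) - \<epsilon>\<^sup>2 * D'\<bar> \<le> \<eta> * \<epsilon>\<^sup>2"
    if \<eta>: "0 < \<eta>" and close: "\<forall>i\<in>I. \<bar>x \<epsilon> i - \<epsilon>\<^sup>2 * y i\<bar> \<le> \<eta> * \<epsilon>\<^sup>2" for \<eta> \<epsilon>
  proof -
    \<comment> \<open>Upper half of the comparison. It also shows that \<open>X \<epsilon>\<close>
      is finite, which must precede any use of \<open>enn2real\<close>.\<close>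
    have "X \<epsilon> \<le> ennreal (\<epsilon>\<^sup>2 * D' + \<eta> * \<epsilon>\<^sup>2)"
      unfolding X_def
    proof (intro SUP_least ennreal_leI)
      fix i assume i: "i \<in> I"
      then have "ennreal (y i) \<le> ennreal D'"
        unfolding D'(1)[symmetric] D_def by (rule SUP_upper)
      then have "y i \<le> D'"
        using D'(2) by simp
      then have "\<epsilon>\<^sup>2 * y i \<le> \<epsilon>\<^sup>2 * D'"
        by (simp add: mult_left_mono)
      then show "x \<epsilon> i \<le> \<epsilon>\<^sup>2 * D' + \<eta> * \<epsilon>\<^sup>2"
        using bspec[OF close i] by linarith
    qed
    moreover from this have X_fin: "X \<epsilon> < \<infinity>"
      using le_less_trans by fastforce
    then obtain X' where X': "X \<epsilon> = ennreal X'" "0 \<le> X'"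
      by (cases "X \<epsilon>") auto
    moreover have "\<epsilon>\<^sup>2 * D' \<le> X' + \<eta> * \<epsilon>\<^sup>2"
    proof -
      \<comment> \<open>Lower half. The scaling is done in \<open>ennreal\<close>, where a constant
        factor commutes with every supremum; \<open>0 \<le> y i\<close> then lets the product be
        taken inside \<open>ennreal\<close>.\<close>
      have "ennreal (\<epsilon>\<^sup>2) * D = (SUP i\<in>I. ennreal (\<epsilon>\<^sup>2) * ennreal (y i))"
        unfolding D_def by (rule SUP_mult_left_ennreal)
      also have "\<dots> \<le> ennreal (X' + \<eta> * \<epsilon>\<^sup>2)"
      proof (rule SUP_least)
        fix i assume i: "i \<in> I"
        then have "ennreal (x \<epsilon> i) \<le> ennreal X'"
          unfolding X'(1)[symmetric] X_def by (rule SUP_upper)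
        then have "x \<epsilon> i \<le> X'"
          using X'(2) by simp
        then have "\<epsilon>\<^sup>2 * y i \<le> X' + \<eta> * \<epsilon>\<^sup>2"
          using bspec[OF close i] by linarith
        then show "ennreal (\<epsilon>\<^sup>2) * ennreal (y i) \<le> ennreal (X' + \<eta> * \<epsilon>\<^sup>2)"
          using y_bounds(1)[OF i] by (simp add: ennreal_mult[symmetric] ennreal_leI)
      qed
      finally have "ennreal (\<epsilon>\<^sup>2 * D') \<le> ennreal (X' + \<eta> * \<epsilon>\<^sup>2)"
        using D' by (simp add: ennreal_mult)
      then show ?thesis
        using X'(2) \<eta> by (subst (asm) ennreal_le_iff) auto
    qed
    \<comment> \<open>\<open>ennreal\<close> sends negative reals to 0, so the upper half reads as
      an inequality of reals only once its right side is known to be nonnegative.\<close>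
    moreover have "0 \<le> \<epsilon>\<^sup>2 * D' + \<eta> * \<epsilon>\<^sup>2"
      using D'(2) \<eta> by simp
    ultimately show ?thesis
      by (auto simp: abs_le_iff)
  qed
  then have ev: "\<forall>\<^sub>F \<epsilon> in at 0. X \<epsilon> < \<infinity> \<and> \<bar>enn2real (X \<epsilon>) - \<epsilon>\<^sup>2 * D'\<bar> \<le> \<eta> * \<epsilon>\<^sup>2"
    if "0 < \<eta>" for \<eta>
    using approx[OF that] that by (auto elim!: eventually_mono)
  have "\<forall>\<^sub>F \<epsilon> in at 0. X \<epsilon> < \<infinity>"
    using ev[of 1] by (auto elim: eventually_mono)
  moreover have "(\<lambda>\<epsilon>. enn2real (X \<epsilon>) - \<epsilon>\<^sup>2 * D') \<in> o[at 0](\<lambda>\<epsilon>. \<epsilon>\<^sup>2)"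
  proof (rule landau_o.smallI)
    show "\<forall>\<^sub>F \<epsilon> in at 0. norm (enn2real (X \<epsilon>) - \<epsilon>\<^sup>2 * D') \<le> c * norm (\<epsilon>\<^sup>2)" if "0 < c" for c
      using ev[OF that] by (rule eventually_mono) simp
  qed
  ultimately show ?thesis
    using D_fin D' by (simp add: quadratic_asymptotic_def X_def D_def)
qed

section \<open>Essential bounds, mixtures of densities, pairing with bounded functions\<close>

lemma norm_inf_le_iff:
  assumes "g \<in> borel_measurable M"
  shows "norm_inf M g \<le> ereal C \<longleftrightarrow> (AE x in M. \<bar>g x\<bar> \<le> C)"
proof
  have meas: "(\<lambda>x. ereal \<bar>g x\<bar>) \<in> borel_measurable M"
    using assms by measurable
  show "AE x in M. \<bar>g x\<bar> \<le> C" if "norm_inf M g \<le> ereal C"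
    using esssup_AE[of "\<lambda>x. ereal \<bar>g x\<bar>" M]
  proof eventually_elim
    case (elim x)
    then show ?case
      using that order_trans unfolding norm_inf_def by fastforce
  qed
  show "norm_inf M g \<le> ereal C" if "AE x in M. \<bar>g x\<bar> \<le> C"
    unfolding norm_inf_def using that by (intro esssup_I meas) auto
qed

lemma Linf_iff: "g \<in> Linf M \<longleftrightarrow> g \<in> borel_measurable M \<and> (\<exists>C. AE x in M. \<bar>g x\<bar> \<le> C)"
proof (cases "g \<in> borel_measurable M")
  case True
  \<comment> \<open>The value -infinity, which occurs for a null measure, also has a real upper
    bound.\<close>
  have "norm_inf M g < \<infinity> \<longleftrightarrow> (\<exists>C. norm_inf M g \<le> ereal C)"
    by (cases "norm_inf M g") auto
  then show ?thesis
    using True by (simp add: Linf_def norm_inf_le_iff)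
qed (simp add: Linf_def)

lemma prob_density_mixture:
  assumes "prob_density M q" "prob_density M q'" "s \<in> {0..1}"
  shows "prob_density M (mixture s q q')"
proof -
  have "AE x in M. 0 \<le> (1 - s) * q x + s * q' x"
    using assms unfolding prob_density_def by (auto elim!: eventually_elim2)
  then show ?thesis
    using assms by (simp add: prob_density_def mixture_def)
qed

text \<open>The Hoelder inequality for the exponents infinity and 1, with an arbitrary a.e. bound
  \<open>K\<close> in place of the essential supremum.\<close>

lemma test_integral_bound:
  fixes \<phi> r :: "'a \<Rightarrow> real"
  assumes \<phi>: "\<phi> \<in> borel_measurable M" "AE x in M. \<bar>\<phi> x\<bar> \<le> K" and r: "integrable M r"
  shows "integrable M (\<lambda>x. \<phi> x * r x)" "\<bar>\<integral>x. \<phi> x * r x \<partial>M\<bar> \<le> K * (\<integral>x. \<bar>r x\<bar> \<partial>M)"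
proof -
  have bound: "AE x in M. \<bar>\<phi> x * r x\<bar> \<le> K * \<bar>r x\<bar>"
    using \<phi>(2) by eventually_elim (simp add: abs_mult mult_right_mono)
  then have "AE x in M. norm (\<phi> x * r x) \<le> norm (K * \<bar>r x\<bar>)"
    by eventually_elim auto
  moreover have "integrable M (\<lambda>x. K * \<bar>r x\<bar>)" "(\<lambda>x. \<phi> x * r x) \<in> borel_measurable M"
    using \<phi>(1) r by auto
  ultimately show int: "integrable M (\<lambda>x. \<phi> x * r x)"
    using Bochner_Integration.integrable_bound by blast
  have "\<bar>\<integral>x. \<phi> x * r x \<partial>M\<bar> \<le> (\<integral>x. \<bar>\<phi> x * r x\<bar> \<partial>M)"
    by (rule integral_abs_bound)
  also have "\<dots> \<le> (\<integral>x. K * \<bar>r x\<bar> \<partial>M)"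
    using int r bound by (intro integral_mono_AE) auto
  finally show "\<bar>\<integral>x. \<phi> x * r x \<partial>M\<bar> \<le> K * (\<integral>x. \<bar>r x\<bar> \<partial>M)"
    by simp
qed

text \<open>The absolute pairing with a fixed test function is a seminorm on integrable functions,
  so the perturbation \<open>r - r'\<close> changes it by at most its own size. It is applied with
  \<open>c = \<epsilon>\<^sup>2\<close>, \<open>g\<close> a difference of second-order coefficients
  and \<open>r\<close>, \<open>r'\<close> the remainders.\<close>

lemma test_integral_lincomb_approx:
  fixes \<phi> g r r' :: "'a \<Rightarrow> real"
  assumes \<phi>: "\<phi> \<in> borel_measurable M" "AE x in M. \<bar>\<phi> x\<bar> \<le> K"
    and int: "integrable M g" "integrable M r" "integrable M r'"
    and eq: "\<And>x. g' x = c * g x + (r x - r' x)"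
  shows "\<bar>\<bar>\<integral>x. \<phi> x * g' x \<partial>M\<bar> - \<bar>c\<bar> * \<bar>\<integral>x. \<phi> x * g x \<partial>M\<bar>\<bar>
    \<le> K * (\<integral>x. \<bar>r x\<bar> \<partial>M) + K * (\<integral>x. \<bar>r' x\<bar> \<partial>M)"
proof -
  note bound = test_integral_bound[OF \<phi>]
  have "\<phi> x * g' x = c * (\<phi> x * g x) + (\<phi> x * r x - \<phi> x * r' x)" for x
    by (simp add: eq algebra_simps)
  then have "(\<integral>x. \<phi> x * g' x \<partial>M) =
      c * (\<integral>x. \<phi> x * g x \<partial>M) + ((\<integral>x. \<phi> x * r x \<partial>M) - (\<integral>x. \<phi> x * r' x \<partial>M))"
    using bound(1)[OF int(1)] bound(1)[OF int(2)] bound(1)[OF int(3)] by simp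
  moreover have "\<bar>c\<bar> * \<bar>\<integral>x. \<phi> x * g x \<partial>M\<bar> = \<bar>c * (\<integral>x. \<phi> x * g x \<partial>M)\<bar>"
    by (simp add: abs_mult)
  ultimately show ?thesis
    using bound(2)[OF int(2)] bound(2)[OF int(3)] by linarith
qed

section \<open>The chart at \<open>p\<close>: closure properties, coefficients, protocol densities
  and the norm\<close>

context
  fixes M :: "'a measure" and p :: "'a \<Rightarrow> real"
  assumes p_density: "prob_density M p" and p_pos: "AE x in M. 0 < p x"
begin

lemma p_integrable: "integrable M p"
  using p_density by (simp add: prob_density_def)

text \<open>Since p > 0 a.e., boundedness of the quotient by \<open>p\<close> becomes domination by
  a multiple of \<open>p\<close>, a form that suits linear combinations and integrability.\<close>

lemma local_chart_iff:
  "g \<in> local_chart M p \<longleftrightarrow>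
    g \<in> borel_measurable M \<and> (\<exists>C. AE x in M. \<bar>g x\<bar> \<le> C * p x) \<and> (\<integral>x. g x \<partial>M) = 0"
proof -
  have "(AE x in M. \<bar>g x / p x\<bar> \<le> C) \<longleftrightarrow> (AE x in M. \<bar>g x\<bar> \<le> C * p x)" for C
    using p_pos by (intro eventually_cong[OF p_pos]) (simp add: abs_divide field_simps)
  moreover have "p \<in> borel_measurable M"
    using p_integrable by simp
  ultimately show ?thesis
    by (auto simp: local_chart_def Linf_iff)
qed

text \<open>Domination by the integrable \<open>p\<close> suffices even when \<open>M\<close> is
  infinite. Hence the zero integral in the chart is genuine, not the default value for a
  nonintegrable function.\<close>

lemma local_chart_integrable:
  assumes "g \<in> local_chart M p"
  shows "integrable M g"
proof -
  obtain C where C: "AE x in M. \<bar>g x\<bar> \<le> C * p x" and g: "g \<in> borel_measurable M"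
    using assms unfolding local_chart_iff by blast
  have "AE x in M. norm (g x) \<le> norm (C * p x)"
    using C by eventually_elim auto
  moreover have "integrable M (\<lambda>x. C * p x)"
    using p_integrable by simp
  ultimately show ?thesis
    using Bochner_Integration.integrable_bound g by blast
qed

lemma local_chart_lincomb:
  assumes "g \<in> local_chart M p" "g' \<in> local_chart M p"
  shows "(\<lambda>x. a * g x + b * g' x) \<in> local_chart M p"
proof -
  obtain C C' where "AE x in M. \<bar>g x\<bar> \<le> C * p x" "AE x in M. \<bar>g' x\<bar> \<le> C' * p x"
    using assms unfolding local_chart_iff by blast
  then have "AE x in M. \<bar>a * g x + b * g' x\<bar> \<le> (\<bar>a\<bar> * C + \<bar>b\<bar> * C') * p x"
  proof eventually_elim
    case (elim x)
    have "\<bar>a * g x + b * g' x\<bar> \<le> \<bar>a\<bar> * \<bar>g x\<bar> + \<bar>b\<bar> * \<bar>g' x\<bar>"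
      using abs_triangle_ineq[of "a * g x" "b * g' x"] by (simp add: abs_mult)
    also have "\<dots> \<le> \<bar>a\<bar> * (C * p x) + \<bar>b\<bar> * (C' * p x)"
      using elim by (intro add_mono mult_left_mono) auto
    finally show ?case
      by (simp add: algebra_simps)
  qed
  moreover have "(\<integral>x. a * g x + b * g' x \<partial>M) = 0"
    using assms assms[THEN local_chart_integrable] by (simp add: local_chart_def)
  moreover have "(\<lambda>x. a * g x + b * g' x) \<in> borel_measurable M"
    using assms by (auto simp: local_chart_def)
  ultimately show ?thesis
    unfolding local_chart_iff by blast
qed

lemma local_chart_zero: "(\<lambda>x. 0) \<in> local_chart M p"
  by (auto simp: local_chart_iff intro!: exI[of _ 0])

lemma local_chart_add:
  assumes "g \<in> local_chart M p" "g' \<in> local_chart M p"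
  shows "(\<lambda>x. g x + g' x) \<in> local_chart M p"
  using local_chart_lincomb[OF assms, of 1 1] by simp

lemma local_chart_diff:
  assumes "g \<in> local_chart M p" "g' \<in> local_chart M p"
  shows "(\<lambda>x. g x - g' x) \<in> local_chart M p"
  using local_chart_lincomb[OF assms, of 1 "-1"] by simp

lemma local_chart_mult:
  assumes "g \<in> local_chart M p"
  shows "(\<lambda>x. c * g x) \<in> local_chart M p"
  using local_chart_lincomb[OF assms assms, of c 0] by simp

lemma local_chart_sum:
  "(\<And>i. i \<in> I \<Longrightarrow> g i \<in> local_chart M p) \<Longrightarrow> (\<lambda>x. \<Sum>i\<in>I. g i x) \<in> local_chart M p"
proof (induction I rule: infinite_finite_induct)
  case (insert i I)
  then have "(\<lambda>x. g i x + (\<Sum>i\<in>I. g i x)) \<in> local_chart M p"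
    by (intro local_chart_add) simp_all
  then show ?case
    using insert.hyps by simp
qed (simp_all add: local_chart_zero)

lemma root_H_chart:
  assumes "\<And>i. i \<in> {1..n} \<Longrightarrow> h i \<in> local_chart M p"
  shows "root_H n w h \<in> local_chart M p"
proof -
  have "(\<lambda>x. inverse (\<Sum>i=1..n. sqrt (w i)) * (\<Sum>i=1..n. sqrt (w i) * h i x)) \<in> local_chart M p"
    using assms by (intro local_chart_mult local_chart_sum)
  then show ?thesis
    by (simp add: root_H_def divide_inverse mult.commute)
qed

lemma coeff_H_chart:
  "(\<And>i. i \<in> block T \<Longrightarrow> h i \<in> local_chart M p) \<Longrightarrow> coeff_H w h T \<in> local_chart M p"
proof (induction T)
  case (Merge l r)
  let ?m = "block_mass w l + block_mass w r"
  have "(\<lambda>x. block_mass w l / ?m * coeff_H w h l x + block_mass w r / ?m * coeff_H w h r x)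
      \<in> local_chart M p"
    using Merge by (intro local_chart_lincomb) (auto simp: block_def)
  then show ?case
    by (simp add: add_divide_distrib)
qed (simp add: block_def)

text \<open>The coefficient \<open>tau\<close> enters as a scalar, so each merge is a linear
  combination of chart elements whatever its value.\<close>

lemma coeff_B_chart:
  assumes "\<And>i. i \<in> block T \<Longrightarrow> h i \<in> local_chart M p"
    and "\<And>i. i \<in> block T \<Longrightarrow> B i \<in> local_chart M p"
  shows "coeff_B M p f w h B T \<in> local_chart M p"
  using assms
proof (induction T)
  case (Merge l r)
  then have "coeff_H w h l \<in> local_chart M p" "coeff_H w h r \<in> local_chart M p"
    by (auto intro!: coeff_H_chart simp: block_def)
  with Merge show ?case
    unfolding coeff_B.simps
    by (intro local_chart_add local_chart_mult local_chart_diff) (auto simp: block_def)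
qed (simp add: block_def)

text \<open>The weights add up to 1, so \<open>p\<close> can be distributed over both
  components.\<close>

lemma mixture_diff_chart:
  assumes "(\<lambda>x. q x - p x) \<in> local_chart M p" "(\<lambda>x. q' x - p x) \<in> local_chart M p"
  shows "(\<lambda>x. mixture s q q' x - p x) \<in> local_chart M p"
proof -
  have "mixture s q q' x - p x = (1 - s) * (q x - p x) + s * (q' x - p x)" for x
    by (simp add: mixture_def algebra_simps)
  then show ?thesis
    using local_chart_lincomb[OF assms] by simp
qed

text \<open>The remainder has mass zero because \<open>q\<close> and \<open>p\<close> both have mass
  one and \<open>h\<close>, \<open>B\<close> have mass zero; finiteness of its weighted norm then
  puts it in the chart. Adding back the two coefficient terms stays there.\<close>

lemma leaf_diff_chart:
  assumes h: "h \<in> local_chart M p" and B: "B \<in> local_chart M p" and q: "prob_density M q"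
    and fin: "norm_p_inf M p (\<lambda>x. q x - p x - a * h x - b * B x) < \<infinity>"
  shows "(\<lambda>x. q x - p x) \<in> local_chart M p"
proof -
  let ?R = "\<lambda>x. q x - p x - a * h x - b * B x"
  have int: "integrable M q" "integrable M p" "integrable M h" "integrable M B"
    using q p_integrable h[THEN local_chart_integrable] B[THEN local_chart_integrable]
    by (simp_all add: prob_density_def)
  then have meas: "q \<in> borel_measurable M" "p \<in> borel_measurable M"
      "h \<in> borel_measurable M" "B \<in> borel_measurable M"
    by auto
  have "(\<lambda>x. ?R x / p x) \<in> Linf M"
    using fin meas by (auto simp: Linf_def norm_p_inf_def)
  moreover have "(\<integral>x. ?R x \<partial>M) = 0"
    using int q p_density h B by (simp add: prob_density_def local_chart_def)
  ultimately have "?R \<in> local_chart M p"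
    using meas by (simp add: local_chart_def)
  then have "(\<lambda>x. ?R x + (a * h x + b * B x)) \<in> local_chart M p"
    by (intro local_chart_add local_chart_lincomb h B)
  then show ?thesis
    by simp
qed

text \<open>The distance is given by the norm only for densities with difference in the chart, so
  both properties are carried up the tree: the leaf expansions start them, and weights in [0,1]
  preserve them at merges. Each merge intersects finitely many neighbourhoods of 0.\<close>

lemma eventually_root_density:
  assumes h: "\<And>i. i \<in> block T \<Longrightarrow> h i \<in> local_chart M p"
    and B: "\<And>i. i \<in> block T \<Longrightarrow> B i \<in> local_chart M p"
    and P: "\<And>i. i \<in> block T \<Longrightarrow> \<forall>\<^sub>F \<epsilon> in at 0. prob_density M (P i \<epsilon>)"
    and expansion: "\<And>i. i \<in> block T \<Longrightarrow>
      ((\<lambda>\<epsilon>. norm_p_inf M p (\<lambda>x. P i \<epsilon> x - p x - \<epsilon> * h i x - \<epsilon>\<^sup>2 * B i x) / ereal (\<epsilon>\<^sup>2))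
        \<longlongrightarrow> 0) (at 0)"
    and t: "\<And>l r. Merge l r \<in> subtrees T \<Longrightarrow> \<forall>\<^sub>F \<epsilon> in at 0. t l r \<epsilon> \<in> {0..1}"
  shows "\<forall>\<^sub>F \<epsilon> in at 0. prob_density M (root_density w P t T \<epsilon>) \<and>
    (\<lambda>x. root_density w P t T \<epsilon> x - p x) \<in> local_chart M p"
  using assms
proof (induction T)
  case (Lf i)
  then have i: "h i \<in> local_chart M p" "B i \<in> local_chart M p"
      "\<forall>\<^sub>F \<epsilon> in at 0. prob_density M (P i \<epsilon>)"
    by (auto simp: block_def)
  have "\<forall>\<^sub>F \<epsilon> in at 0.
      norm_p_inf M p (\<lambda>x. P i \<epsilon> x - p x - \<epsilon> * h i x - \<epsilon>\<^sup>2 * B i x) / ereal (\<epsilon>\<^sup>2) < 1"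
    using Lf(4) by (intro order_tendstoD(2)[of _ 0]) (auto simp: block_def)
  with i(3) eventually_neq_at_within[of 0 0 UNIV] show ?case
  proof eventually_elim
    case (elim \<epsilon>)
    \<comment> \<open>An infinite numerator over the positive real \<open>\<epsilon>\<^sup>2\<close>
      would give an infinite quotient, but the quotient is below 1.\<close>
    then have "norm_p_inf M p (\<lambda>x. P i \<epsilon> x - p x - \<epsilon> * h i x - \<epsilon>\<^sup>2 * B i x) < \<infinity>"
      by (auto simp: less_top)
    then show ?case
      using leaf_diff_chart[OF i(1,2) elim(1)] elim(1) by (simp add: root_density_def)
  qed
next
  case (Merge l r)
  have "\<forall>\<^sub>F \<epsilon> in at 0. prob_density M (root_density w P t l \<epsilon>) \<and>
      (\<lambda>x. root_density w P t l \<epsilon> x - p x) \<in> local_chart M p"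
    using Merge.prems by (intro Merge.IH) (auto simp: block_def)
  moreover have "\<forall>\<^sub>F \<epsilon> in at 0. prob_density M (root_density w P t r \<epsilon>) \<and>
      (\<lambda>x. root_density w P t r \<epsilon> x - p x) \<in> local_chart M p"
    using Merge.prems by (intro Merge.IH) (auto simp: block_def)
  moreover have "\<forall>\<^sub>F \<epsilon> in at 0. t l r \<epsilon> \<in> {0..1}"
    by (rule Merge.prems) simp
  ultimately show ?case
  proof eventually_elim
    case (elim \<epsilon>)
    have "root_density w P t (Merge l r) \<epsilon> =
        mixture (t l r \<epsilon>) (root_density w P t l \<epsilon>) (root_density w P t r \<epsilon>)"
      by (simp add: root_density_def)
    then show ?case
      using elim by (simp add: prob_density_mixture mixture_diff_chart)
  qed
qed

text \<open>The norm counterpart of \<open>test_integral_lincomb_approx\<close>. The norm axioms are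
  available only on the chart, so every function met on the way is placed there first.\<close>

lemma norm_on_chart_lincomb_approx:
  assumes N: "norm_on_chart M p N"
    and chart: "g \<in> local_chart M p" "r \<in> local_chart M p" "r' \<in> local_chart M p"
    and eq: "\<And>x. g' x = c * g x + (r x - r' x)"
  shows "\<bar>N g' - \<bar>c\<bar> * N g\<bar> \<le> N r + N r'"
proof -
  have tri: "N (\<lambda>x. u x + v x) \<le> N u + N v" if "u \<in> local_chart M p" "v \<in> local_chart M p" for u v
    using N that by (auto simp: norm_on_chart_def)
  have scale: "N (\<lambda>x. a * u x) = \<bar>a\<bar> * N u" if "u \<in> local_chart M p" for a u
    using N that by (auto simp: norm_on_chart_def)
  have diff: "N (\<lambda>x. u x - v x) \<le> N u + N v"
    if "u \<in> local_chart M p" "v \<in> local_chart M p" for u v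
    using tri[OF that(1) local_chart_mult[OF that(2), of "-1"]] scale[OF that(2), of "-1"] by simp
  have cg: "(\<lambda>x. c * g x) \<in> local_chart M p" and rr: "(\<lambda>x. r x - r' x) \<in> local_chart M p"
    using chart by (auto intro: local_chart_mult local_chart_diff)
  have g'_eq: "g' = (\<lambda>x. c * g x + (r x - r' x))"
    using eq by auto
  have g': "g' \<in> local_chart M p"
    unfolding g'_eq by (intro local_chart_add cg rr)
  have "N g' \<le> N (\<lambda>x. c * g x) + N (\<lambda>x. r x - r' x)"
    unfolding g'_eq by (intro tri cg rr)
  \<comment> \<open>Here \<open>c * g\<close> is written as \<open>g'\<close> minus the
    perturbation.\<close>
  moreover have "N (\<lambda>x. c * g x) \<le> N g' + N (\<lambda>x. r x - r' x)"
    using diff[OF g' rr] by (simp add: eq)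
  moreover have "N (\<lambda>x. r x - r' x) \<le> N r + N r'"
    by (intro diff chart)
  ultimately show ?thesis
    using scale[OF chart(1), of c] by (simp add: abs_le_iff)
qed

end

section \<open>Expansion of the two diameters\<close>

theorem proposition11:
  fixes M :: "'a measure"
    and p :: "'a \<Rightarrow> real"
    and f :: "real \<Rightarrow> real"
    and n :: nat
    and w :: "nat \<Rightarrow> real"
    and h B :: "nat \<Rightarrow> 'a \<Rightarrow> real"
    and P :: "nat \<Rightarrow> real \<Rightarrow> 'a \<Rightarrow> real"
    and U :: "otree set"
    and t :: "otree \<Rightarrow> otree \<Rightarrow> real \<Rightarrow> real"
    and N :: "('a \<Rightarrow> real) \<Rightarrow> real"
    and d :: "('a \<Rightarrow> real) \<Rightarrow> ('a \<Rightarrow> real) \<Rightarrow> real"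
    and Q :: "('a \<Rightarrow> real) set"
  assumes p_density: "prob_density M p" "AE x in M. 0 < p x"
    and f_generator: "generator f"
    and n_ge: "2 \<le> n"
    and w_pos: "\<And>i. i \<in> {1..n} \<Longrightarrow> 0 < w i"
    and P_density: "\<And>i. i \<in> {1..n} \<Longrightarrow> \<forall>\<^sub>F \<epsilon> in at 0. prob_density M (P i \<epsilon>)"
    and h_chart: "\<And>i. i \<in> {1..n} \<Longrightarrow> h i \<in> local_chart M p"
    and B_chart: "\<And>i. i \<in> {1..n} \<Longrightarrow> B i \<in> local_chart M p"
    and P_expansion: "\<And>i. i \<in> {1..n} \<Longrightarrow>
      ((\<lambda>\<epsilon>. norm_p_inf M p (\<lambda>x. P i \<epsilon> x - p x - \<epsilon> * h i x - \<epsilon>\<^sup>2 * B i x) / ereal (\<epsilon>\<^sup>2))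
        \<longlongrightarrow> 0) (at 0)"
    and U_admissible: "admissible M p f n w h B U"
    and t_protocol: "mass_carrying_protocol M f w P U t"
    and N_norm: "norm_on_chart M p N"
    and d_norm: "\<And>q q'. prob_density M q \<Longrightarrow> prob_density M q' \<Longrightarrow>
      (\<lambda>x. q x - q' x) \<in> local_chart M p \<Longrightarrow> d q q' = N (\<lambda>x. q x - q' x)"
    and expansion_N: "uniform_limit U
      (\<lambda>\<epsilon> T. N (\<lambda>x. root_density w P t T \<epsilon> x - p x - \<epsilon> * root_H n w h x
                      - \<epsilon>\<^sup>2 * coeff_B M p f w h B T x) / \<epsilon>\<^sup>2)
      (\<lambda>T. 0) (at 0)"
    and Q_measurable: "Q \<subseteq> borel_measurable M"
    and Q_bounded: "(SUP \<phi>\<in>Q. norm_inf M \<phi>) < \<infinity>"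
    and expansion_L1: "\<And>T. T \<in> U \<Longrightarrow>
      (\<lambda>\<epsilon>. \<integral>x. \<bar>root_density w P t T \<epsilon> x - p x - \<epsilon> * root_H n w h x
                 - \<epsilon>\<^sup>2 * coeff_B M p f w h B T x\<bar> \<partial>M) \<in> o[at 0](\<lambda>\<epsilon>. \<epsilon>\<^sup>2)"
  shows "quadratic_asymptotic (AOD d w P t U) (Delta2 N (coeff_B M p f w h B ` U)) \<and>
         quadratic_asymptotic (AOD_Q M Q w P t U) (Delta2_Q M Q (coeff_B M p f w h B ` U))"
proof -
  let ?F = "root_density w P t"
  let ?C = "coeff_B M p f w h B"
  let ?R = "\<lambda>\<epsilon> T x. ?F T \<epsilon> x - p x - \<epsilon> * root_H n w h x - \<epsilon>\<^sup>2 * ?C T x"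
  note diff = local_chart_diff[OF p_density]
  have U_trees: "U \<subseteq> ordered_trees n"
    using U_admissible by (simp add: admissible_def)
  have U_finite: "finite U"
    using U_trees finite_leaves_eq finite_subset unfolding ordered_trees_def by blast
  have block: "i \<in> {1..n}" if "T \<in> U" "i \<in> block T" for T i
  proof -
    \<comment> \<open>The list stops before \<open>n + 1\<close>, so the labels are exactly 1 to
      n.\<close>
    have "leaves T = [1..<n + 1]"
      using that(1) U_trees by (auto simp del: upt_Suc simp: ordered_trees_def)
    then have "block T = {1..<n + 1}"
      by (simp del: upt_Suc add: block_def)
    then show ?thesis
      using that(2) by auto
  qed
  have C_chart: "?C T \<in> local_chart M p" if "T \<in> U" for T
    using block[OF that] by (intro coeff_B_chart[OF p_density] h_chart B_chart)
  have "\<forall>\<^sub>F \<epsilon> in at 0. prob_density M (?F T \<epsilon>) \<and> (\<lambda>x. ?F T \<epsilon> x - p x) \<in> local_chart M p"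
    if "T \<in> U" for T
  proof (rule eventually_root_density[OF p_density, where h = h and B = B])
    fix l r assume "Merge l r \<in> subtrees T"
    then show "\<forall>\<^sub>F \<epsilon> in at 0. t l r \<epsilon> \<in> {0..1}"
      using t_protocol that
      by (fastforce simp: mass_carrying_protocol_def local_solution_def elim: eventually_mono)
  qed (use block[OF that] in \<open>auto intro: h_chart B_chart P_density P_expansion\<close>)
  \<comment> \<open>Finiteness of \<open>U\<close> gives one neighbourhood of 0 that serves all
    trees.\<close>
  then have F_ev: "\<forall>\<^sub>F \<epsilon> in at 0. \<forall>T\<in>U.
      prob_density M (?F T \<epsilon>) \<and> (\<lambda>x. ?F T \<epsilon> x - p x) \<in> local_chart M p"
    using U_finite by (simp add: eventually_ball_finite)
  have R_chart: "?R \<epsilon> T \<in> local_chart M p"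
    if "T \<in> U" "(\<lambda>x. ?F T \<epsilon> x - p x) \<in> local_chart M p" for T \<epsilon>
    using that by (intro diff[OF diff[OF that(2)]] local_chart_mult[OF p_density]
      root_H_chart[OF p_density] C_chart h_chart)
  have F_diff: "?F T \<epsilon> x - ?F T' \<epsilon> x = \<epsilon>\<^sup>2 * (?C T x - ?C T' x) + (?R \<epsilon> T x - ?R \<epsilon> T' x)"
    for T T' \<epsilon> x
    by (simp add: algebra_simps)

  \<comment> \<open>The norm diameter, with the nested suprema indexed by pairs of trees;
    \<open>SUP_Times\<close> translates back to \<open>AOD\<close> and \<open>Delta2\<close>
    afterwards.\<close>
  have "quadratic_asymptotic
      (\<lambda>\<epsilon>. SUP (T, T')\<in>U \<times> U. ennreal (d (?F T \<epsilon>) (?F T' \<epsilon>)))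
      (SUP (T, T')\<in>U \<times> U. ennreal (N (\<lambda>x. ?C T x - ?C T' x)))"
    unfolding case_prod_beta
  proof (rule quadratic_asymptotic_SUP)
    let ?y = "\<lambda>i. N (\<lambda>x. ?C (fst i) x - ?C (snd i) x)"
    show "0 \<le> ?y i" if "i \<in> U \<times> U" for i
      using that N_norm diff C_chart by (auto simp: norm_on_chart_def)
    show "?y i \<le> Max (?y ` (U \<times> U))" if "i \<in> U \<times> U" for i
      using that U_finite by (intro Max_ge) auto
    \<comment> \<open>Two remainders enter each difference, hence the share
      \<open>\<eta> / 2\<close> for each tree.\<close>
    fix \<eta> :: real assume "0 < \<eta>"
    then have "\<forall>\<^sub>F \<epsilon> in at 0. \<forall>T\<in>U. dist (N (?R \<epsilon> T) / \<epsilon>\<^sup>2) 0 < \<eta> / 2"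
      using expansion_N by (intro uniform_limitD) auto
    with F_ev eventually_neq_at_within[of 0 0 UNIV] show "\<forall>\<^sub>F \<epsilon> in at 0. \<forall>i\<in>U \<times> U.
        \<bar>d (?F (fst i) \<epsilon>) (?F (snd i) \<epsilon>) - \<epsilon>\<^sup>2 * ?y i\<bar> \<le> \<eta> * \<epsilon>\<^sup>2"
    proof eventually_elim
      case (elim \<epsilon>)
      have R_small: "N (?R \<epsilon> T) \<le> \<eta> / 2 * \<epsilon>\<^sup>2" if "T \<in> U" for T
      proof -
        have "N (?R \<epsilon> T) / \<epsilon>\<^sup>2 \<le> \<eta> / 2"
          using bspec[OF elim(3) that] unfolding dist_real_def by linarith
        then show ?thesis
          using elim(2) by (simp add: pos_divide_le_eq)
      qed
      show ?case
      proof
        fix i assume "i \<in> U \<times> U"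
        then have T: "fst i \<in> U" "snd i \<in> U"
          by auto
        let ?G = "\<lambda>x. ?F (fst i) \<epsilon> x - ?F (snd i) \<epsilon> x"
        \<comment> \<open>Both densities differ from \<open>p\<close> by chart elements, and
          \<open>p\<close> cancels in the difference.\<close>
        have "?G \<in> local_chart M p"
          using diff[of "\<lambda>x. ?F (fst i) \<epsilon> x - p x" "\<lambda>x. ?F (snd i) \<epsilon> x - p x"] elim(1) T by simp
        then have d_eq: "d (?F (fst i) \<epsilon>) (?F (snd i) \<epsilon>) = N ?G"
          using elim(1) T by (intro d_norm) auto
        have "\<bar>N ?G - \<bar>\<epsilon>\<^sup>2\<bar> * ?y i\<bar> \<le> N (?R \<epsilon> (fst i)) + N (?R \<epsilon> (snd i))"
          using elim(1) T
          by (intro norm_on_chart_lincomb_approx[OF p_density N_norm] diff[OF C_chart C_chart]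
              R_chart F_diff) auto
        then show "\<bar>d (?F (fst i) \<epsilon>) (?F (snd i) \<epsilon>) - \<epsilon>\<^sup>2 * ?y i\<bar> \<le> \<eta> * \<epsilon>\<^sup>2"
          using R_small[OF T(1)] R_small[OF T(2)] by (simp add: d_eq)
      qed
    qed
  qed
  then have "quadratic_asymptotic (AOD d w P t U) (Delta2 N (?C ` U))"
    by (simp add: AOD_def[abs_def] Delta2_def SUP_Times image_comp comp_def)

  moreover obtain K where K: "0 < K" "\<And>\<phi>. \<phi> \<in> Q \<Longrightarrow> AE x in M. \<bar>\<phi> x\<bar> \<le> K"
  proof -
    \<comment> \<open>The maximum with 1 makes \<open>K\<close> positive, as the later division by
      \<open>2 * K\<close> requires. For empty \<open>Q\<close> the supremum in \<open>ereal\<close>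
      is -infinity, and \<open>K = 1\<close> serves.\<close>
    obtain K where "(SUP \<phi>\<in>Q. norm_inf M \<phi>) \<le> ereal K" "0 < K"
    proof (cases "SUP \<phi>\<in>Q. norm_inf M \<phi>")
      case (real r)
      then show ?thesis
        using that[of "max r 1"] by simp
    qed (use Q_bounded that[of 1] in auto)
    moreover from this have "AE x in M. \<bar>\<phi> x\<bar> \<le> K" if "\<phi> \<in> Q" for \<phi>
      using that Q_measurable norm_inf_le_iff[of \<phi> M K] by (auto simp: SUP_le_iff)
    ultimately show ?thesis
      using that by blast
  qed
  have C_int: "integrable M (\<lambda>x. ?C T x - ?C T' x)" if "T \<in> U" "T' \<in> U" for T T'
    using local_chart_integrable[OF p_density] diff C_chart that by blast
  \<comment> \<open>The test-function diameter, indexed by triples. Uniformity over \<open>Q\<close>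
    comes from the common bound \<open>K\<close>, uniformity over trees from finiteness of
    \<open>U\<close>.\<close>
  have "quadratic_asymptotic
      (\<lambda>\<epsilon>. SUP (\<phi>, T, T')\<in>Q \<times> U \<times> U. ennreal \<bar>\<integral>x. \<phi> x * (?F T \<epsilon> x - ?F T' \<epsilon> x) \<partial>M\<bar>)
      (SUP (\<phi>, T, T')\<in>Q \<times> U \<times> U. ennreal \<bar>\<integral>x. \<phi> x * (?C T x - ?C T' x) \<partial>M\<bar>)"
    unfolding case_prod_beta
  proof (rule quadratic_asymptotic_SUP)
    let ?y = "\<lambda>i. \<bar>\<integral>x. fst i x * (?C (fst (snd i)) x - ?C (snd (snd i)) x) \<partial>M\<bar>"
    \<comment> \<open>\<open>Q\<close> may be infinite, so the maximum is taken over pairs of trees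
      of a bound that does not involve the test function.\<close>
    let ?L = "\<lambda>i. K * (\<integral>x. \<bar>?C (fst i) x - ?C (snd i) x\<bar> \<partial>M)"
    show "0 \<le> ?y i" for i
      by simp
    show "?y i \<le> Max (?L ` (U \<times> U))" if "i \<in> Q \<times> U \<times> U" for i
    proof -
      have "?y i \<le> ?L (snd i)"
        using that K Q_measurable C_int by (intro test_integral_bound) auto
      also have "\<dots> \<le> Max (?L ` (U \<times> U))"
        using that U_finite by (intro Max_ge) auto
      finally show ?thesis .
    qed
    fix \<eta> :: real assume "0 < \<eta>"
    \<comment> \<open>Pairing costs a factor \<open>K\<close> and two remainders occur, so each L1
      remainder is allowed \<open>\<eta> / (2 * K)\<close>.\<close>
    then have \<eta>K: "0 < \<eta> / (2 * K)"
      using K by simp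
    have "\<forall>\<^sub>F \<epsilon> in at 0. (\<integral>x. \<bar>?R \<epsilon> T x\<bar> \<partial>M) \<le> \<eta> / (2 * K) * \<epsilon>\<^sup>2" if "T \<in> U" for T
      using landau_o.smallD[OF expansion_L1[OF that] \<eta>K] by simp
    then have "\<forall>\<^sub>F \<epsilon> in at 0. \<forall>T\<in>U. (\<integral>x. \<bar>?R \<epsilon> T x\<bar> \<partial>M) \<le> \<eta> / (2 * K) * \<epsilon>\<^sup>2"
      using U_finite by (simp add: eventually_ball_finite)
    with F_ev show "\<forall>\<^sub>F \<epsilon> in at 0. \<forall>i\<in>Q \<times> U \<times> U.
        \<bar>\<bar>\<integral>x. fst i x * (?F (fst (snd i)) \<epsilon> x - ?F (snd (snd i)) \<epsilon> x) \<partial>M\<bar> - \<epsilon>\<^sup>2 * ?y i\<bar>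
          \<le> \<eta> * \<epsilon>\<^sup>2"
    proof eventually_elim
      case (elim \<epsilon>)
      have R_small: "K * (\<integral>x. \<bar>?R \<epsilon> T x\<bar> \<partial>M) \<le> \<eta> / 2 * \<epsilon>\<^sup>2" if "T \<in> U" for T
        using mult_left_mono[OF bspec[OF elim(2) that], of K] K(1) by simp
      have R_int: "integrable M (?R \<epsilon> T)" if "T \<in> U" for T
        using elim(1) that by (intro local_chart_integrable[OF p_density] R_chart) auto
      show ?case
      proof
        fix i assume "i \<in> Q \<times> U \<times> U"
        then have i: "fst i \<in> Q" and T: "fst (snd i) \<in> U" "snd (snd i) \<in> U"
          by auto
        have "\<bar>\<bar>\<integral>x. fst i x * (?F (fst (snd i)) \<epsilon> x - ?F (snd (snd i)) \<epsilon> x) \<partial>M\<bar>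
            - \<bar>\<epsilon>\<^sup>2\<bar> * ?y i\<bar>
          \<le> K * (\<integral>x. \<bar>?R \<epsilon> (fst (snd i)) x\<bar> \<partial>M) + K * (\<integral>x. \<bar>?R \<epsilon> (snd (snd i)) x\<bar> \<partial>M)"
          using i Q_measurable
          by (intro test_integral_lincomb_approx K C_int R_int T F_diff) auto
        then show "\<bar>\<bar>\<integral>x. fst i x * (?F (fst (snd i)) \<epsilon> x - ?F (snd (snd i)) \<epsilon> x) \<partial>M\<bar>
            - \<epsilon>\<^sup>2 * ?y i\<bar> \<le> \<eta> * \<epsilon>\<^sup>2"
          using R_small[OF T(1)] R_small[OF T(2)] by simp
      qed
    qed
  qed
  then have "quadratic_asymptotic (AOD_Q M Q w P t U) (Delta2_Q M Q (?C ` U))"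
    by (simp add: AOD_Q_def[abs_def] Delta2_Q_def SUP_Times image_comp comp_def)

  ultimately show ?thesis
    by blast
qed

end
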